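(* Let $\mathcal{X}$ be a separable Banach space with a Borel probability measure $\mu_0$ (the prior), let $\mathcal{Y}=\mathbb{R}^p$, and let $\mathcal{D}$ be a metric space. For $d\in\mathcal{D}$ let $\pi(\cdot|x;d)$ be a likelihood density and, for $N\in\mathbb{N}$, let $\pi_N(\cdot|x;d)$ be a surrogate likelihood density, with evidences $\pi(y;d)=\int_{\mathcal{X}}\pi(y|x;d)\,d\mu_0(x)$ and $\pi_N(y;d)=\int_{\mathcal{X}}\pi_N(y|x;d)\,d\mu_0(x)$. Define $$U(d)=\int_{\mathcal{Y}}\int_{\mathcal{X}}\log\left(\frac{\pi(y|x;d)}{\pi(y;d)}\right)\pi(y|x;d)\,d\mu_0(x)\,dy,\qquad U_N(d)=\int_{\mathcal{Y}}\int_{\mathcal{X}}\log\left(\frac{\pi_N(y|x;d)}{\pi_N(y;d)}\right)\pi_N(y|x;d)\,d\mu_0(x)\,dy.$$ Assume: (A1) There exist $C_1>0$ and a function $\psi:\mathbb{N}\to\mathbb{R}_+$ with $\psi(N)\to0$ as $N\to\infty$ such that for all $d\in\mathcal{D}$ and all $N\in\mathbb{N}$, $$\mathbb{E}^{\mu_0}\left[D_{\mathrm{KL}}\left(\pi_N(\cdot|X;d)\,\|\,\pi(\cdot|X;d)\right)\right]\le C_1\psi(N).$$ (A2) For any converging sequence $d_N\to d$ in $\mathcal{D}$, $$\lim_{N\to\infty}\mathbb{E}^{\mu_0}\left[D_{\mathrm{KL}}\left(\pi(\cdot|X;d_N)\,\|\,\pi(\cdot|X;d)\right)\right]=0.$$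 (A3) There exists $C_0>0$ such that for every $N\in\mathbb{N}$, every $d\in\mathcal{D}$ and every sequence $d_N\to d$ in $\mathcal{D}$, $$\int_{\mathcal{Y}}\int_{\mathcal{X}}\log^2\left(\frac{\pi(y|x;d)}{\pi(y;d)}\right)\left[\pi(y|x;d)+\pi_N(y|x;d)+\pi(y|x;d_N)\right]d\mu_0(x)\,dy<C_0.$$ Suppose that for each $N\in\mathbb{N}$, $d_N^*\in\operatorname{arg\,max}_{d\in\mathcal{D}}U_N(d)$. Then the limit $d^*$ of any converging subsequence of $\{d_N^*\}_{N=1}^\infty$ is a maximizer of $U$, that is, $d^*\in\operatorname{arg\,max}_{d\in\mathcal{D}}U(d)$. Moreover, $$\liminf_{N\to\infty}U_N(d_N^* )=U(d^* ).$$ In particular, if $\{d_N^*\}_{N=1}^\infty$ converges to $d^*$ in $\mathcal{D}$, then $d^*$ is a maximizer of $U$ and $$\lim_{N\to\infty}U_N(d_N^* )=U(d^* ).$$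
   Context: A likelihood density $\pi(\cdot|x;d)$ is, for each $x\in\mathcal{X}$ and $d\in\mathcal{D}$, a probability density on $\mathbb{R}^p$ with respect to Lebesgue measure $dy$, jointly measurable in $(x,y)$; likewise for the surrogates. $\mathbb{E}^{\mu_0}$ denotes expectation over $X\sim\mu_0$. For probability densities $q,r$ on $\mathbb{R}^p$, $D_{\mathrm{KL}}(q\,\|\,r)=\int\log(q/r)\,q\,dy\in[0,\infty]$ is the Kullback--Leibler divergence, equal to $+\infty$ if $q\,dy$ is not absolutely continuous with respect to $r\,dy$. Conventions: an integrand is $0$ wherever the density (or sum of densities) multiplying the logarithm or squared logarithm vanishes, and $\log^2$ of a ratio with zero numerator is $+\infty$ where the multiplying density is positive. *)

theory Defs
  imports "HOL-Probability.Probability"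
begin

definition likelihood_density ::
    "('x::topological_space \<Rightarrow> 'y::euclidean_space \<Rightarrow> real) \<Rightarrow> bool" where
  "likelihood_density q \<longleftrightarrow>
     (\<lambda>(x, y). q x y) \<in> borel_measurable (borel \<Otimes>\<^sub>M borel) \<and>
     (\<forall>x y. 0 \<le> q x y) \<and>
     (\<forall>x. (\<integral>\<^sup>+y. ennreal (q x y) \<partial>lborel) = 1)"

(* For a likelihood density the integral can diverge only for y in a Lebesgue null set
   (Tonelli); there the Bochner integral is 0. *)
definition evidence :: "'x measure \<Rightarrow> ('x \<Rightarrow> 'y \<Rightarrow> real) \<Rightarrow> 'y \<Rightarrow> real" where
  "evidence \<mu> q y = (\<integral>x. q x y \<partial>\<mu>)"

(* ln 0 = 0 and t / 0 = 0 in HOL: the integrand is 0 where q x y = 0, and {q x y > 0} meets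
   {evidence = 0} in a null set.  The negative part of the integrand is always integrable
   (t ln t \<ge> -1/e), so the integral fails to exist only if it is +\<infinity>. *)
definition expected_utility ::
    "'x measure \<Rightarrow> ('x \<Rightarrow> 'y::euclidean_space \<Rightarrow> real) \<Rightarrow> real" where
  "expected_utility \<mu> q =
     (\<integral>y. (\<integral>x. ln (q x y / evidence \<mu> q y) * q x y \<partial>\<mu>) \<partial>lborel)"

(* For probability densities with q dy absolutely continuous with respect to r dy, the
   negative part of ln (q / r) q has integral at most 1/e, so that non-integrability means
   that the integral is +\<infinity>. *)
definition kl_div ::
    "('y::euclidean_space \<Rightarrow> real) \<Rightarrow> ('y \<Rightarrow> real) \<Rightarrow> ennreal" where
  "kl_div q r =
     (if absolutely_continuous (density lborel (\<lambda>y. ennreal (r y))) (density lborel (\<lambda>y. ennreal (q y)))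
         \<and> integrable lborel (\<lambda>y. ln (q y / r y) * q y)
      then ennreal (\<integral>y. ln (q y / r y) * q y \<partial>lborel)
      else \<infinity>)"

(* log^2 (a / b) * w with the conventions for vanishing a and w; HOL's ln 0 = 0 would
   otherwise make the integrand 0 where a = 0 < w. *)
definition log_sq_weighted :: "real \<Rightarrow> real \<Rightarrow> real \<Rightarrow> ennreal" where
  "log_sq_weighted a b w =
     (if w = 0 then 0 else if a = 0 then \<infinity> else ennreal ((ln (a / b))\<^sup>2 * w))"

end

theory Submission
  imports Defs
begin

text \<open>
  Fix \<open>d\<close>, let \<open>p, q\<close> be two likelihood densities with evidences \<open>P, Q\<close>, and work on the product of
  the prior and Lebesgue measure. Then \<open>q ln (q / Q) - p ln (p / P)\<close> is the sum of
  \<open>q ln (q / Q) - q ln (p / P)\<close> and \<open>(q - p) ln (p / P)\<close>. Two applications of \<open>ln t \<le> t - 1\<close> enclose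
  the integral of the first summand between \<open>0\<close> and the expected Kullback--Leibler divergence \<open>K\<close>
  of \<open>q\<close> from \<open>p\<close>; since \<open>K\<close> dominates the squared Hellinger distance, the integral of the second
  is at most \<open>K / (2 \<epsilon>) + \<epsilon> C\<close> for every \<open>\<epsilon> > 0\<close>, where \<open>C\<close> bounds the second log-moment.
  Hence the surrogate utilities converge uniformly in \<open>d\<close> (A1) and the true utility is sequentially
  continuous (A2), and maximizers and maxima pass to the limit.
\<close>

section \<open>Pointwise inequalities for densities\<close>

text \<open>Both bounds are \<open>ln t \<le> t - 1\<close> multiplied by \<open>q\<close>: the
  lower one with \<open>t = (p * zq) / (q * zp)\<close>, the upper one with
  \<open>t = zp / zq\<close>, the rest of the log-ratio being \<open>ln (q / p)\<close>. When
  \<open>zp\<close>, \<open>zq\<close> are the evidences, \<open>p * zq / zp\<close> and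
  \<open>q * zp / zq\<close> have integral at most \<open>1\<close>, so \<open>q\<close> and
  \<open>- p\<close> offset them after integration. The bracket in the upper bound isolates the
  nonnegative divergence integrand.\<close>

lemma log_ratio_bounds:
  fixes p q zp zq :: real
  assumes "0 \<le> p" "0 \<le> q" "0 \<le> zp" "0 \<le> zq"
    and "p = 0 \<Longrightarrow> q = 0" "zp = 0 \<Longrightarrow> p = 0" "zq = 0 \<Longrightarrow> q = 0"
  shows "q - p * zq / zp \<le> ln (q / zq) * q - ln (p / zp) * q"
    and "ln (q / zq) * q - ln (p / zp) * q \<le> (ln (q / p) * q - q + p) - p + q * zp / zq"
proof -
  consider "q = 0" | "q > 0" "p > 0" "zp > 0" "zq > 0"
    using assms by fastforce
  then have "q - p * zq / zp \<le> ln (q / zq) * q - ln (p / zp) * q \<and>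
    ln (q / zq) * q - ln (p / zp) * q \<le> (ln (q / p) * q - q + p) - p + q * zp / zq"
  proof cases
    case 1
    with assms show ?thesis by simp
  next
    case 2
    have "ln ((p * zq) / (q * zp)) \<le> (p * zq) / (q * zp) - 1"
      using 2 by (intro ln_le_minus_one) simp
    then have "q * ln ((p * zq) / (q * zp)) \<le> q * ((p * zq) / (q * zp) - 1)"
      using 2 by (intro mult_left_mono) auto
    also have "\<dots> = p * zq / zp - q"
      using 2 by (simp add: field_simps)
    finally have 3: "q * ln ((p * zq) / (q * zp)) \<le> p * zq / zp - q" .
    have "ln (zp / zq) \<le> zp / zq - 1"
      using 2 by (intro ln_le_minus_one) simp
    then have "q * ln (zp / zq) \<le> q * (zp / zq - 1)"
      using 2 by (intro mult_left_mono) auto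
    also have "\<dots> = q * zp / zq - q"
      by (simp add: algebra_simps)
    finally have 4: "q * ln (zp / zq) \<le> q * zp / zq - q" .
    show ?thesis
      using 2 3 4 by (simp add: ln_div ln_mult algebra_simps)
  qed
  then show "q - p * zq / zp \<le> ln (q / zq) * q - ln (p / zp) * q"
    and "ln (q / zq) * q - ln (p / zp) * q \<le> (ln (q / p) * q - q + p) - p + q * zp / zq"
    by auto
qed

text \<open>Take \<open>ln t \<le> t - 1\<close> at \<open>t = sqrt p / sqrt q\<close> and multiply
  by \<open>2 * q\<close>; the factor \<open>2\<close> undoes the square root inside the logarithm.
  The correction \<open>- q + p\<close>, which has integral zero for two densities, lets the
  comparison of squared Hellinger distance and divergence hold already pointwise.\<close>

lemma sqrt_diff_sq_le_log_ratio:
  fixes p q :: real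
  assumes "0 \<le> p" "0 \<le> q" "p = 0 \<Longrightarrow> q = 0"
  shows "(sqrt q - sqrt p)\<^sup>2 \<le> ln (q / p) * q - q + p"
proof (cases "q = 0")
  case False
  then have pos: "q > 0" "p > 0" using assms by (auto simp: less_le)
  have "ln (sqrt p / sqrt q) \<le> sqrt p / sqrt q - 1"
    using pos by (intro ln_le_minus_one) simp
  from mult_left_mono[OF this, of "2 * q"]
  have "2 * q * ln (sqrt p / sqrt q) \<le> 2 * (q / sqrt q) * sqrt p - 2 * q"
    using pos by (simp add: field_simps)
  then have "q * (ln p - ln q) \<le> 2 * sqrt q * sqrt p - 2 * q"
    using pos by (simp add: ln_div ln_sqrt real_div_sqrt algebra_simps)
  then show ?thesis
    using pos by (simp add: ln_div power2_diff algebra_simps)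
qed (use assms in simp)

text \<open>Splitting \<open>q - p = (sqrt q - sqrt p) * (sqrt q + sqrt p)\<close> and applying AM-GM with weight
  \<open>\<epsilon>\<close> replaces Pinsker's inequality and the Cauchy--Schwarz inequality.\<close>

lemma weighted_diff_le_log_ratio:
  fixes p q l :: real
  assumes "0 \<le> p" "0 \<le> q" "p = 0 \<Longrightarrow> q = 0" "0 < \<epsilon>"
  shows "\<bar>l * q - l * p\<bar> \<le> (ln (q / p) * q - q + p) / (2 * \<epsilon>) + \<epsilon> * (l\<^sup>2 * (p + q))"
proof -
  define u v where "u = \<bar>sqrt q - sqrt p\<bar>" and "v = \<bar>l\<bar> * (sqrt q + sqrt p)"
  have "l * q - l * p = l * ((sqrt q - sqrt p) * (sqrt q + sqrt p))"
    using assms by (simp add: algebra_simps)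
  then have "\<bar>l * q - l * p\<bar> = u * v"
    using assms by (simp add: u_def v_def abs_mult)
  also have "\<dots> \<le> u\<^sup>2 / (2 * \<epsilon>) + \<epsilon> * v\<^sup>2 / 2"
  proof -
    have "0 \<le> (u - \<epsilon> * v)\<^sup>2" by simp
    then show ?thesis
      using assms by (simp add: power2_eq_square field_simps)
  qed
  also have "\<dots> \<le> (ln (q / p) * q - q + p) / (2 * \<epsilon>) + \<epsilon> * (l\<^sup>2 * (p + q))"
  proof (intro add_mono divide_right_mono)
    show "u\<^sup>2 \<le> ln (q / p) * q - q + p"
      using sqrt_diff_sq_le_log_ratio[of p q] assms by (simp add: u_def)
    have "(sqrt q + sqrt p)\<^sup>2 \<le> 2 * (p + q)"
      using sum_squares_bound[of "sqrt q" "sqrt p"] assms by (simp add: power2_sum)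
    then have "l\<^sup>2 * (sqrt q + sqrt p)\<^sup>2 \<le> l\<^sup>2 * (2 * (p + q))"
      by (rule mult_left_mono) simp
    moreover have "v\<^sup>2 = l\<^sup>2 * (sqrt q + sqrt p)\<^sup>2"
      by (simp add: v_def power_mult_distrib)
    ultimately have "v\<^sup>2 \<le> 2 * (l\<^sup>2 * (p + q))"
      by linarith
    then have "\<epsilon> * v\<^sup>2 \<le> \<epsilon> * (2 * (l\<^sup>2 * (p + q)))"
      using assms by (intro mult_left_mono) auto
    then show "\<epsilon> * v\<^sup>2 / 2 \<le> \<epsilon> * (l\<^sup>2 * (p + q))"
      by linarith
  qed (use assms in simp)
  finally show ?thesis .
qed

lemma likelihood_nonneg: "likelihood_density q \<Longrightarrow> 0 \<le> q x y"
  for q :: "'x::topological_space \<Rightarrow> 'y::euclidean_space \<Rightarrow> real"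
  by (simp add: likelihood_density_def)

section \<open>Evidences and integrals on the product space\<close>

context
  fixes \<mu> :: "'x::topological_space measure"
  assumes prob: "prob_space \<mu>" and sets_prior [measurable_cong]: "sets \<mu> = sets borel"
begin

interpretation prob_space \<mu> by (rule prob)
interpretation pair_sigma_finite \<mu> "lborel :: 'y::euclidean_space measure" ..

lemma likelihood_measurable:
  fixes q :: "'x \<Rightarrow> 'y::euclidean_space \<Rightarrow> real"
  assumes "likelihood_density q"
  shows "(\<lambda>(x, y). q x y) \<in> borel_measurable (\<mu> \<Otimes>\<^sub>M lborel)"
proof -
  have "sets (\<mu> \<Otimes>\<^sub>M lborel) = sets (borel \<Otimes>\<^sub>M (borel :: 'y measure))"
    by (intro sets_pair_measure_cong sets_prior) simp
  then show ?thesis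
    using assms by (simp add: likelihood_density_def cong: measurable_cong_sets)
qed

lemma likelihood_integrable:
  fixes q :: "'x \<Rightarrow> 'y::euclidean_space \<Rightarrow> real"
  assumes q: "likelihood_density q"
  shows "integrable (\<mu> \<Otimes>\<^sub>M lborel) (\<lambda>(x, y). q x y)"
    and "(\<integral>(x, y). q x y \<partial>(\<mu> \<Otimes>\<^sub>M lborel)) = 1"
proof -
  note [measurable] = likelihood_measurable[OF q]
  have "(\<integral>\<^sup>+z. ennreal (case z of (x, y) \<Rightarrow> q x y) \<partial>(\<mu> \<Otimes>\<^sub>M lborel))
      = (\<integral>\<^sup>+x. (\<integral>\<^sup>+y. ennreal (q x y) \<partial>lborel) \<partial>\<mu>)"
    by (subst lborel.nn_integral_fst[symmetric]) auto
  also have "\<dots> = 1"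
    using q by (simp add: likelihood_density_def emeasure_space_1)
  finally have 1: "(\<integral>\<^sup>+z. ennreal (case z of (x, y) \<Rightarrow> q x y) \<partial>(\<mu> \<Otimes>\<^sub>M lborel)) = 1" .
  show i: "integrable (\<mu> \<Otimes>\<^sub>M lborel) (\<lambda>(x, y). q x y)"
    using 1 likelihood_nonneg[OF q]
    by (intro integrableI_nonneg) auto
  show "(\<integral>(x, y). q x y \<partial>(\<mu> \<Otimes>\<^sub>M lborel)) = 1"
    using 1 likelihood_nonneg[OF q]
    by (subst integral_eq_nn_integral) auto
qed

lemma evidence_measurable:
  fixes q :: "'x \<Rightarrow> 'y::euclidean_space \<Rightarrow> real"
  assumes q: "likelihood_density q"
  shows "evidence \<mu> q \<in> borel_measurable lborel"
proof -
  note [measurable] = likelihood_measurable[OF q]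
  show ?thesis unfolding evidence_def by measurable
qed

lemma evidence_nonneg: "likelihood_density q \<Longrightarrow> 0 \<le> evidence \<mu> q y"
  for q :: "'x \<Rightarrow> 'y::euclidean_space \<Rightarrow> real"
  by (simp add: evidence_def likelihood_nonneg)

text \<open>Where \<open>\<lambda>x. q x y\<close> is not integrable, \<open>evidence\<close> takes
  the default value \<open>0\<close> of the Bochner integral. Integrability on the product excludes
  this for almost every \<open>y\<close>.\<close>

lemma AE_evidence:
  fixes q :: "'x \<Rightarrow> 'y::euclidean_space \<Rightarrow> real"
  assumes q: "likelihood_density q"
  shows "AE y in lborel. (\<integral>\<^sup>+x. ennreal (q x y) \<partial>\<mu>) = ennreal (evidence \<mu> q y)"
  using AE_integrable_snd[OF likelihood_integrable(1)[OF q]]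
proof eventually_elim
  case (elim y)
  then show ?case
    unfolding evidence_def
    by (intro nn_integral_eq_integral) (auto simp: likelihood_nonneg[OF q])
qed

lemma nn_integral_evidence:
  fixes q :: "'x \<Rightarrow> 'y::euclidean_space \<Rightarrow> real"
  assumes q: "likelihood_density q"
  shows "(\<integral>\<^sup>+y. ennreal (evidence \<mu> q y) \<partial>lborel) = 1"
proof -
  note [measurable] = likelihood_measurable[OF q]
  have "(\<integral>\<^sup>+y. ennreal (evidence \<mu> q y) \<partial>lborel) = (\<integral>\<^sup>+y. (\<integral>\<^sup>+x. ennreal (q x y) \<partial>\<mu>) \<partial>lborel)"
    using AE_evidence[OF q] by (intro nn_integral_cong_AE) auto
  also have "\<dots> = (\<integral>\<^sup>+x. (\<integral>\<^sup>+y. ennreal (q x y) \<partial>lborel) \<partial>\<mu>)"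
    by (rule Fubini') measurable
  also have "\<dots> = 1"
    using q by (simp add: likelihood_density_def emeasure_space_1)
  finally show ?thesis .
qed

text \<open>A nonnegative function with integral zero vanishes almost everywhere. Hence the quotient
  by a zero evidence, which is \<open>0\<close> by default, only occurs under the weight
  \<open>q x y = 0\<close>, up to a null set.\<close>

lemma AE_likelihood_zero:
  fixes q :: "'x \<Rightarrow> 'y::euclidean_space \<Rightarrow> real"
  assumes q: "likelihood_density q"
  shows "AE (x, y) in \<mu> \<Otimes>\<^sub>M lborel. evidence \<mu> q y = 0 \<longrightarrow> q x y = 0"
proof -
  note [measurable] = likelihood_measurable[OF q] evidence_measurable[OF q]
  have "AE y in lborel. AE x in \<mu>. evidence \<mu> q y = 0 \<longrightarrow> q x y = 0"
    using AE_evidence[OF q] AE_space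
  proof eventually_elim
    case (elim y)
    show ?case
    proof (cases "evidence \<mu> q y = 0")
      case True
      have [measurable]: "(\<lambda>x. q x y) \<in> borel_measurable \<mu>" by measurable
      have "(\<integral>\<^sup>+x. ennreal (q x y) \<partial>\<mu>) = 0" using elim True by simp
      then have "AE x in \<mu>. ennreal (q x y) = 0"
        by (subst (asm) nn_integral_0_iff_AE) auto
      then show ?thesis
        by eventually_elim (use likelihood_nonneg[OF q] in \<open>auto simp: ennreal_eq_0_iff antisym\<close>)
    qed simp
  qed
  \<comment> \<open>\<open>AE_pair_iff\<close> expects the first factor outermost, so the
    quantifiers are exchanged before passing to the product.\<close>
  then have "AE x in \<mu>. AE y in lborel. evidence \<mu> q y = 0 \<longrightarrow> q x y = 0"
    by (subst AE_commute) measurable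
  then have "AE z in \<mu> \<Otimes>\<^sub>M lborel. evidence \<mu> q (snd z) = 0 \<longrightarrow> q (fst z) (snd z) = 0"
    by (subst (asm) AE_pair_iff) measurable
  then show ?thesis
    by (simp add: split_beta)
qed

text \<open>Integrating over \<open>x\<close> first turns \<open>p\<close> into its evidence, which
  cancels the denominator and leaves the evidence of \<open>q\<close>, of total mass
  \<open>1\<close>. Where the evidence of \<open>p\<close> is zero the quotient is \<open>0\<close>
  and the mass of \<open>q\<close> may be lost; hence an inequality, in the direction needed for the
  correction terms of \<open>log_ratio_bounds\<close>.\<close>

lemma integral_evidence_ratio:
  fixes p q :: "'x \<Rightarrow> 'y::euclidean_space \<Rightarrow> real"
  assumes p: "likelihood_density p" and q: "likelihood_density q"
  defines "h \<equiv> \<lambda>(x, y). p x y * evidence \<mu> q y / evidence \<mu> p y"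
  shows "integrable (\<mu> \<Otimes>\<^sub>M lborel) h" and "integral\<^sup>L (\<mu> \<Otimes>\<^sub>M lborel) h \<le> 1"
proof -
  note [measurable] = likelihood_measurable[OF p] evidence_measurable[OF p] evidence_measurable[OF q]
  have h [measurable]: "h \<in> borel_measurable (\<mu> \<Otimes>\<^sub>M lborel)"
    unfolding h_def by measurable
  have nonneg: "0 \<le> h z" for z
    by (auto simp: h_def split_beta likelihood_nonneg[OF p] evidence_nonneg[OF p] evidence_nonneg[OF q])
  have "(\<integral>\<^sup>+z. ennreal (h z) \<partial>(\<mu> \<Otimes>\<^sub>M lborel)) = (\<integral>\<^sup>+y. (\<integral>\<^sup>+x. ennreal (h (x, y)) \<partial>\<mu>) \<partial>lborel)"
    by (subst nn_integral_snd[symmetric]) auto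
  also have "\<dots> \<le> (\<integral>\<^sup>+y. ennreal (evidence \<mu> q y) \<partial>lborel)"
  proof (intro nn_integral_mono_AE)
    show "AE y in lborel. (\<integral>\<^sup>+x. ennreal (h (x, y)) \<partial>\<mu>) \<le> ennreal (evidence \<mu> q y)"
      using AE_evidence[OF p] AE_space
    proof eventually_elim
      case (elim y)
      define c where "c = evidence \<mu> q y / evidence \<mu> p y"
      have c: "0 \<le> c" by (simp add: c_def evidence_nonneg p q)
      have [measurable]: "(\<lambda>x. p x y) \<in> borel_measurable \<mu>" by measurable
      have "(\<integral>\<^sup>+x. ennreal (h (x, y)) \<partial>\<mu>) = (\<integral>\<^sup>+x. ennreal c * ennreal (p x y) \<partial>\<mu>)"
        using c likelihood_nonneg[OF p]
        by (intro nn_integral_cong) (simp add: h_def c_def mult.commute flip: ennreal_mult)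
      also have "\<dots> = ennreal (c * evidence \<mu> p y)"
        using elim c evidence_nonneg[OF p, of y] by (simp add: nn_integral_cmult ennreal_mult)
      also have "\<dots> \<le> ennreal (evidence \<mu> q y)"
        by (intro ennreal_leI) (simp add: c_def evidence_nonneg[OF q])
      finally show ?case .
    qed
  qed
  finally have le: "(\<integral>\<^sup>+z. ennreal (h z) \<partial>(\<mu> \<Otimes>\<^sub>M lborel)) \<le> 1"
    by (simp add: nn_integral_evidence[OF q])
  then show "integrable (\<mu> \<Otimes>\<^sub>M lborel) h"
    using nonneg by (intro integrableI_nonneg) (auto simp: le_less_trans[OF _ ennreal_one_less_top])
  show "integral\<^sup>L (\<mu> \<Otimes>\<^sub>M lborel) h \<le> 1"
    using le nonneg by (intro integral_real_bounded) auto
qed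

text \<open>The terms \<open>- q + p\<close> integrate to \<open>0\<close> and make the integrand nonnegative. As the bound holds for
  every \<open>x\<close>, it can be integrated without knowing that \<^const>\<open>kl_div\<close> is measurable in \<open>x\<close>.\<close>

lemma nn_integral_le_kl_div:
  fixes p q :: "'x \<Rightarrow> 'y::euclidean_space \<Rightarrow> real"
  assumes p: "likelihood_density p" and q: "likelihood_density q" and x: "x \<in> space \<mu>"
  shows "(\<integral>\<^sup>+y. ennreal (ln (q x y / p x y) * q x y - q x y + p x y) \<partial>lborel)
    \<le> kl_div (q x) (p x)"
proof (cases "absolutely_continuous (density lborel (\<lambda>y. ennreal (p x y))) (density lborel (\<lambda>y. ennreal (q x y)))
         \<and> integrable lborel (\<lambda>y. ln (q x y / p x y) * q x y)")
  case True
  have dens: "r x \<in> borel_measurable lborel" "integrable lborel (r x)" "integral\<^sup>L lborel (r x) = 1"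
    if r: "likelihood_density r" for r :: "'x \<Rightarrow> 'y \<Rightarrow> real"
  proof -
    note [measurable] = likelihood_measurable[OF r]
    have "(\<lambda>y. r x y) \<in> borel_measurable lborel" using x by measurable
    then show m: "r x \<in> borel_measurable lborel" by simp
    have 1: "(\<integral>\<^sup>+y. ennreal (r x y) \<partial>lborel) = 1" using r by (simp add: likelihood_density_def)
    show "integrable lborel (r x)"
      using m 1 likelihood_nonneg[OF r] by (intro integrableI_nonneg) auto
    show "integral\<^sup>L lborel (r x) = 1"
      using m 1 likelihood_nonneg[OF r] by (subst integral_eq_nn_integral) auto
  qed
  note [measurable] = dens(1)[OF p] dens(1)[OF q]
  \<comment> \<open>Absolute continuity enters through this zero set alone: it is null for
    \<open>p\<close>, hence for \<open>q\<close>, so \<open>q\<close> vanishes almost everywhere on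
    it.\<close>
  let ?S = "{y \<in> space lborel. p x y = 0}"
  have S [measurable]: "?S \<in> sets lborel" by measurable
  have "?S \<in> null_sets (density lborel (\<lambda>y. ennreal (p x y)))"
    by (subst null_sets_density_iff) auto
  then have "?S \<in> null_sets (density lborel (\<lambda>y. ennreal (q x y)))"
    using True by (auto simp: absolutely_continuous_def)
  then have "AE y in lborel. y \<in> ?S \<longrightarrow> \<not> 0 < ennreal (q x y)"
    by (subst (asm) null_sets_density_iff) auto
  then have "AE y in lborel. p x y = 0 \<longrightarrow> q x y = 0"
    by eventually_elim (use likelihood_nonneg[OF q] in \<open>auto simp: antisym\<close>)
  then have "AE y in lborel. 0 \<le> ln (q x y / p x y) * q x y - q x y + p x y"
  proof eventually_elim
    case (elim y)
    then show ?case
      using order_trans[OF zero_le_power2 sqrt_diff_sq_le_log_ratio[of "p x y" "q x y"]]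
        likelihood_nonneg[OF q] likelihood_nonneg[OF p] by blast
  qed
  then have "(\<integral>\<^sup>+y. ennreal (ln (q x y / p x y) * q x y - q x y + p x y) \<partial>lborel)
    = ennreal (\<integral>y. ln (q x y / p x y) * q x y - q x y + p x y \<partial>lborel)"
    using True dens(2)[OF p] dens(2)[OF q] by (intro nn_integral_eq_integral) auto
  also have "(\<integral>y. ln (q x y / p x y) * q x y - q x y + p x y \<partial>lborel)
      = (\<integral>y. ln (q x y / p x y) * q x y \<partial>lborel)"
    using True dens(2,3)[OF p] dens(2,3)[OF q] by simp
  finally show ?thesis
    using True by (simp add: kl_div_def)
qed (auto simp: kl_div_def)

section \<open>Comparison of two expected utilities\<close>

lemma expected_utility_diff_le:
  fixes p q :: "'x \<Rightarrow> 'y::euclidean_space \<Rightarrow> real"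
  assumes p: "likelihood_density p" and q: "likelihood_density q"
    and kl: "(\<integral>\<^sup>+x. kl_div (q x) (p x) \<partial>\<mu>) \<le> ennreal K" and K: "0 \<le> K"
    and sq: "(\<integral>\<^sup>+y. (\<integral>\<^sup>+x. log_sq_weighted (p x y) (evidence \<mu> p y) (p x y + q x y) \<partial>\<mu>) \<partial>lborel)
      \<le> ennreal C" and C: "0 \<le> C"
    and \<epsilon>: "0 < \<epsilon>"
  shows "\<bar>expected_utility \<mu> q - expected_utility \<mu> p\<bar> \<le> K + K / (2 * \<epsilon>) + \<epsilon> * C"
proof -
  note [measurable] = likelihood_measurable[OF p] likelihood_measurable[OF q]
    evidence_measurable[OF p] evidence_measurable[OF q]
  let ?M = "\<mu> \<Otimes>\<^sub>M (lborel :: 'y measure)"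
  note nonneg = likelihood_nonneg[OF p] likelihood_nonneg[OF q]
    evidence_nonneg[OF p] evidence_nonneg[OF q]

  define w where "w = (\<lambda>(x, y). log_sq_weighted (p x y) (evidence \<mu> p y) (p x y + q x y))"
  have w_meas [measurable]: "w \<in> borel_measurable ?M"
    unfolding w_def log_sq_weighted_def by measurable
  have "(\<integral>\<^sup>+z. w z \<partial>?M) = (\<integral>\<^sup>+y. (\<integral>\<^sup>+x. w (x, y) \<partial>\<mu>) \<partial>lborel)"
    by (subst nn_integral_snd[symmetric]) auto
  with sq have w_le: "(\<integral>\<^sup>+z. w z \<partial>?M) \<le> ennreal C"
    by (simp add: w_def)
  then have "(\<integral>\<^sup>+z. w z \<partial>?M) \<noteq> \<infinity>"
    using le_less_trans[OF _ ennreal_less_top] by fastforce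
  \<comment> \<open>\<open>w\<close> is infinite where \<open>p\<close> vanishes and \<open>q\<close> does not.\<close>
  from nn_integral_PInf_AE[OF w_meas this]
  have ac: "AE (x, y) in ?M. p x y = 0 \<longrightarrow> q x y = 0"
    by eventually_elim (auto simp: w_def log_sq_weighted_def split: if_splits)

  have good: "AE (x, y) in ?M. (p x y = 0 \<longrightarrow> q x y = 0) \<and>
      (evidence \<mu> p y = 0 \<longrightarrow> p x y = 0) \<and> (evidence \<mu> q y = 0 \<longrightarrow> q x y = 0)"
    using ac AE_likelihood_zero[OF p] AE_likelihood_zero[OF q]
    by eventually_elim auto

  \<comment> \<open>Nonnegativity of \<open>G\<close> on the product comes from \<open>ac\<close>,
    that is, from the second log-moment; the divergence then bounds its integral section by
    section.\<close>
  define G where "G = (\<lambda>(x, y). ln (q x y / p x y) * q x y - q x y + p x y)"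
  have G_meas [measurable]: "G \<in> borel_measurable ?M"
    unfolding G_def by measurable
  have G_nonneg: "AE z in ?M. 0 \<le> G z"
    using ac
  proof eventually_elim
    case (elim z)
    then show ?case
      using order_trans[OF zero_le_power2 sqrt_diff_sq_le_log_ratio] nonneg
      by (auto simp: G_def)
  qed
  have "(\<integral>\<^sup>+z. ennreal (G z) \<partial>?M) = (\<integral>\<^sup>+x. (\<integral>\<^sup>+y. ennreal (G (x, y)) \<partial>lborel) \<partial>\<mu>)"
    by (subst lborel.nn_integral_fst[symmetric]) auto
  also have "\<dots> \<le> (\<integral>\<^sup>+x. kl_div (q x) (p x) \<partial>\<mu>)"
    by (intro nn_integral_mono) (simp add: G_def nn_integral_le_kl_div[OF p q])
  also note kl
  finally have G_le: "(\<integral>\<^sup>+z. ennreal (G z) \<partial>?M) \<le> ennreal K" .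
  then have G_int: "integrable ?M G"
    using G_nonneg by (intro integrableI_nonneg) (auto simp: le_less_trans[OF _ ennreal_less_top])
  have G_integral: "integral\<^sup>L ?M G \<le> K"
    using G_le K by (rule integral_real_bounded[rotated])

  \<comment> \<open>\<open>V\<close> is the real-valued version of \<open>w\<close>; the two differ
    only where \<open>w\<close> is infinite.\<close>
  define V where "V = (\<lambda>(x, y). (ln (p x y / evidence \<mu> p y))\<^sup>2 * (p x y + q x y))"
  have V_meas [measurable]: "V \<in> borel_measurable ?M"
    unfolding V_def by measurable
  have V_nonneg: "0 \<le> V z" for z
    by (auto simp: V_def split_beta nonneg)
  have "(\<integral>\<^sup>+z. ennreal (V z) \<partial>?M) \<le> (\<integral>\<^sup>+z. w z \<partial>?M)"
    by (intro nn_integral_mono) (auto simp: V_def w_def log_sq_weighted_def)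
  also note w_le
  finally have V_le: "(\<integral>\<^sup>+z. ennreal (V z) \<partial>?M) \<le> ennreal C" .
  then have V_int: "integrable ?M V"
    using V_nonneg by (intro integrableI_nonneg) (auto simp: le_less_trans[OF _ ennreal_less_top])
  have V_integral: "integral\<^sup>L ?M V \<le> C"
    using V_le C by (rule integral_real_bounded[rotated])

  define P Q where "P = (\<lambda>(x, y). p x y)" and "Q = (\<lambda>(x, y). q x y)"
  have P_int: "integrable ?M P" "integral\<^sup>L ?M P = 1"
    using likelihood_integrable[OF p] by (auto simp: P_def)
  have Q_int: "integrable ?M Q" "integral\<^sup>L ?M Q = 1"
    using likelihood_integrable[OF q] by (auto simp: Q_def)

  \<comment> \<open>\<open>A\<close> and \<open>D\<close> are the utility integrands of
    \<open>q\<close> and \<open>p\<close>. The cross term \<open>B\<close> weights the log-ratio of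
    \<open>p\<close> by \<open>q\<close>, so \<open>A - B\<close> changes only the logarithm and
    \<open>B - D\<close> only the weight.\<close>
  define A B D where "A = (\<lambda>(x, y). ln (q x y / evidence \<mu> q y) * q x y)"
    and "B = (\<lambda>(x, y). ln (p x y / evidence \<mu> p y) * q x y)"
    and "D = (\<lambda>(x, y). ln (p x y / evidence \<mu> p y) * p x y)"
  have A_meas [measurable]: "A \<in> borel_measurable ?M"
    unfolding A_def by measurable
  have B_meas [measurable]: "B \<in> borel_measurable ?M"
    unfolding B_def by measurable
  have D_meas [measurable]: "D \<in> borel_measurable ?M"
    unfolding D_def by measurable
  \<comment> \<open>From \<open>\<bar>l\<bar> \<le> 1 + l\<^sup>2\<close>: total mass and second
    log-moment together dominate the first log-moment, which makes \<open>B\<close> and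
    \<open>D\<close> integrable.\<close>
  have abs_le: "\<bar>l\<bar> * a \<le> (a + b) + l\<^sup>2 * (a + b)" if "0 \<le> a" "0 \<le> b" for l a b :: real
  proof -
    have "\<bar>l\<bar> \<le> 1 + l\<^sup>2"
      using sum_squares_bound[of 1 "\<bar>l\<bar>"] by simp
    then have "\<bar>l\<bar> * (a + b) \<le> (1 + l\<^sup>2) * (a + b)"
      using that by (intro mult_right_mono) auto
    moreover have "\<bar>l\<bar> * a \<le> \<bar>l\<bar> * (a + b)"
      using that by (intro mult_left_mono) auto
    ultimately show ?thesis by (simp add: algebra_simps)
  qed
  have PQV: "integrable ?M (\<lambda>z. (P z + Q z) + V z)"
    using P_int Q_int V_int by auto
  have B_int: "integrable ?M B"
    by (rule Bochner_Integration.integrable_bound[OF PQV B_meas])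
      (use nonneg V_nonneg abs_le[of "q _ _" "p _ _"] in
        \<open>auto simp: B_def P_def Q_def V_def abs_mult add.commute intro!: AE_I2\<close>)
  have D_int: "integrable ?M D"
    by (rule Bochner_Integration.integrable_bound[OF PQV D_meas])
      (use nonneg V_nonneg abs_le[of "p _ _" "q _ _"] in
        \<open>auto simp: D_def P_def Q_def V_def abs_mult add.commute intro!: AE_I2\<close>)

  define R1 R2 where "R1 = (\<lambda>(x, y). p x y * evidence \<mu> q y / evidence \<mu> p y)"
    and "R2 = (\<lambda>(x, y). q x y * evidence \<mu> p y / evidence \<mu> q y)"
  have R1: "integrable ?M R1" "integral\<^sup>L ?M R1 \<le> 1"
    using integral_evidence_ratio[OF p q] by (auto simp: R1_def)
  have R2: "integrable ?M R2" "integral\<^sup>L ?M R2 \<le> 1"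
    using integral_evidence_ratio[OF q p] by (auto simp: R2_def)

  have bounds: "AE z in ?M. Q z - R1 z \<le> A z - B z \<and> A z - B z \<le> G z - P z + R2 z"
    using good
  proof eventually_elim
    case (elim z)
    obtain x y where z: "z = (x, y)" by (cases z)
    show ?case
      using elim log_ratio_bounds[of "p x y" "q x y" "evidence \<mu> p y" "evidence \<mu> q y"] nonneg
      by (auto simp: z Q_def R1_def A_def B_def G_def P_def R2_def)
  qed
  \<comment> \<open>\<open>V\<close> does not control the log-ratio of \<open>q\<close> in
    \<open>A\<close>. Instead \<open>A - B\<close> is enclosed between integrable functions, and
    \<open>A\<close> is recovered by adding \<open>B\<close>.\<close>
  have "integrable ?M (\<lambda>z. A z - B z)"
  proof (rule Bochner_Integration.integrable_bound)
    show "integrable ?M (\<lambda>z. \<bar>Q z - R1 z\<bar> + \<bar>G z - P z + R2 z\<bar>)"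
      using P_int Q_int R1 R2 G_int by auto
    show "AE z in ?M. norm (A z - B z) \<le> norm (\<bar>Q z - R1 z\<bar> + \<bar>G z - P z + R2 z\<bar>)"
      using bounds by eventually_elim auto
  qed measurable
  from Bochner_Integration.integrable_add[OF this B_int]
  have A_int: "integrable ?M A" by simp

  \<comment> \<open>The masses offset each other: \<open>Q - R1\<close> has integral at least
    \<open>1 - 1\<close>, and \<open>G - P + R2\<close> below has integral at most
    \<open>K - 1 + 1\<close>.\<close>
  have lower: "0 \<le> integral\<^sup>L ?M A - integral\<^sup>L ?M B"
  proof -
    have "(\<integral>z. Q z - R1 z \<partial>?M) \<le> (\<integral>z. A z - B z \<partial>?M)"
      using bounds by (intro integral_mono_AE) (auto simp: Q_int R1 A_int B_int)
    then show ?thesis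
      using R1 Q_int by (simp add: A_int B_int)
  qed
  have upper: "integral\<^sup>L ?M A - integral\<^sup>L ?M B \<le> K"
  proof -
    have "(\<integral>z. A z - B z \<partial>?M) \<le> (\<integral>z. G z - P z + R2 z \<partial>?M)"
      using bounds by (intro integral_mono_AE) (auto simp: P_int G_int R2 A_int B_int)
    then show ?thesis
      using R2 P_int G_int G_integral by (simp add: A_int B_int)
  qed
  have BD: "\<bar>integral\<^sup>L ?M B - integral\<^sup>L ?M D\<bar> \<le> K / (2 * \<epsilon>) + \<epsilon> * C"
  proof -
    have "\<bar>integral\<^sup>L ?M B - integral\<^sup>L ?M D\<bar> \<le> (\<integral>z. \<bar>B z - D z\<bar> \<partial>?M)"
      using integral_abs_bound[of ?M "\<lambda>z. B z - D z"] by (simp add: B_int D_int)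
    also have "\<dots> \<le> (\<integral>z. G z / (2 * \<epsilon>) + \<epsilon> * V z \<partial>?M)"
    proof (rule integral_mono_AE)
      show "AE z in ?M. \<bar>B z - D z\<bar> \<le> G z / (2 * \<epsilon>) + \<epsilon> * V z"
        using ac
      proof eventually_elim
        case (elim z)
        obtain x y where z: "z = (x, y)" by (cases z)
        show ?case
          using elim weighted_diff_le_log_ratio[of "p x y" "q x y" \<epsilon>] nonneg \<epsilon>
          by (auto simp: z B_def D_def G_def V_def)
      qed
    qed (auto simp: B_int D_int G_int V_int)
    also have "\<dots> = integral\<^sup>L ?M G / (2 * \<epsilon>) + \<epsilon> * integral\<^sup>L ?M V"
      by (simp add: G_int V_int)
    also have "\<dots> \<le> K / (2 * \<epsilon>) + \<epsilon> * C"
      using G_integral V_integral \<epsilon> by (intro add_mono divide_right_mono mult_left_mono) auto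
    finally show ?thesis .
  qed
  have "expected_utility \<mu> q = integral\<^sup>L ?M A" "expected_utility \<mu> p = integral\<^sup>L ?M D"
    using integral_snd[of "\<lambda>x y. A (x, y)"] integral_snd[of "\<lambda>x y. D (x, y)"] A_int D_int
    by (simp_all add: expected_utility_def A_def D_def)
  then show ?thesis
    using lower upper BD by linarith
qed

text \<open>Since \<open>C\<close> is fixed, \<open>\<epsilon>\<close> is chosen first with
  \<open>\<epsilon> * C = e / 2\<close>, and then \<open>K\<close> with
  \<open>K + K / (2 * \<epsilon>) = e / 4\<close>. As \<open>K\<close> depends only on
  \<open>C\<close> and \<open>e\<close>, one threshold serves all pairs of densities.\<close>

lemma expected_utility_diff_small:
  fixes C e :: real
  assumes C: "0 < C" and e: "0 < e"
  obtains K where "0 < K"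
    and "\<And>p q :: 'x \<Rightarrow> 'y::euclidean_space \<Rightarrow> real.
      likelihood_density p \<Longrightarrow> likelihood_density q \<Longrightarrow>
      (\<integral>\<^sup>+x. kl_div (q x) (p x) \<partial>\<mu>) \<le> ennreal K \<Longrightarrow>
      (\<integral>\<^sup>+y. (\<integral>\<^sup>+x. log_sq_weighted (p x y) (evidence \<mu> p y) (p x y + q x y) \<partial>\<mu>) \<partial>lborel) \<le> ennreal C \<Longrightarrow>
      \<bar>expected_utility \<mu> q - expected_utility \<mu> p\<bar> < e"
proof
  define \<epsilon> where "\<epsilon> = e / (2 * C)"
  define c where "c = 1 + 1 / (2 * \<epsilon>)"
  define K where "K = e / (4 * c)"
  have \<epsilon>: "0 < \<epsilon>" "\<epsilon> * C = e / 2" using C e by (auto simp: \<epsilon>_def)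
  then have pos: "0 < c" by (simp add: c_def add_pos_pos)
  then show K: "0 < K" using e by (simp add: K_def)
  have "K + K / (2 * \<epsilon>) = K * c" by (simp add: c_def algebra_simps)
  also have "\<dots> = e / 4" using pos by (simp add: K_def)
  finally have small: "K + K / (2 * \<epsilon>) + \<epsilon> * C < e" using \<epsilon> e by simp
  show "\<bar>expected_utility \<mu> q - expected_utility \<mu> p\<bar> < e"
    if "likelihood_density p" "likelihood_density q"
      "(\<integral>\<^sup>+x. kl_div (q x) (p x) \<partial>\<mu>) \<le> ennreal K"
      "(\<integral>\<^sup>+y. (\<integral>\<^sup>+x. log_sq_weighted (p x y) (evidence \<mu> p y) (p x y + q x y) \<partial>\<mu>) \<partial>lborel) \<le> ennreal C"
    for p q :: "'x \<Rightarrow> 'y \<Rightarrow> real"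
    using expected_utility_diff_le[OF that(1-3) _ that(4) _ \<epsilon>(1)] K C small by simp
qed

end

section \<open>Maximizers and maxima in the limit\<close>

lemma log_sq_weighted_mono: "0 \<le> w \<Longrightarrow> w \<le> w' \<Longrightarrow> log_sq_weighted a b w \<le> log_sq_weighted a b w'"
  by (auto simp: log_sq_weighted_def intro!: ennreal_leI mult_left_mono)

lemma is_arg_max_UNIV_iff: "is_arg_max f (\<lambda>x. x \<in> UNIV) a \<longleftrightarrow> (\<forall>x. f x \<le> f a)"
  for f :: "'a \<Rightarrow> 'b::linorder"
  by (auto simp: is_arg_max_def not_less)

text \<open>Along the subsequence, \<open>f x\<close> is close to \<open>g (r k) x\<close>, at most
  \<open>g (r k) (m (r k))\<close>, which is close to \<open>f (m (r k))\<close> and so to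
  \<open>f l\<close>. Once \<open>l\<close> maximizes \<open>f\<close>, the maxima converge along
  the whole sequence: \<open>g n (m n)\<close> is at least \<open>g n l\<close>, near
  \<open>f l\<close>, and exceeds \<open>f (m n) \<le> f l\<close> by less than the uniform
  error.\<close>

lemma arg_max_uniform_limit:
  fixes f :: "'a::topological_space \<Rightarrow> real"
  assumes unif: "\<And>e. 0 < e \<Longrightarrow> \<forall>\<^sub>F n in sequentially. \<forall>x. \<bar>g n x - f x\<bar> < e"
    and cont: "\<And>X x. X \<longlonglongrightarrow> x \<Longrightarrow> (\<lambda>n. f (X n)) \<longlonglongrightarrow> f x"
    and max: "\<And>n x. g n x \<le> g n (m n)"
    and r: "strict_mono r" and lim: "(m \<circ> r) \<longlonglongrightarrow> l"
  shows "f x \<le> f l" and "(\<lambda>n. g n (m n)) \<longlonglongrightarrow> f l"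
proof -
  have le: "f x \<le> f l" for x
  proof (rule field_le_epsilon)
    fix e :: real assume "0 < e"
    then have e: "0 < e / 3" by simp
    have "(\<lambda>k. f (m (r k))) \<longlonglongrightarrow> f l" using cont[OF lim] by simp
    then have "\<forall>\<^sub>F k in sequentially. \<bar>f (m (r k)) - f l\<bar> < e / 3"
      using e unfolding tendsto_iff dist_real_def by blast
    moreover have "\<forall>\<^sub>F k in sequentially. \<forall>x. \<bar>g (r k) x - f x\<bar> < e / 3"
      using eventually_subseq[OF r unif[OF e]] .
    ultimately have "\<forall>\<^sub>F k in sequentially. f x \<le> f l + e"
    proof eventually_elim
      case (elim k)
      then have "\<bar>g (r k) x - f x\<bar> < e / 3" "\<bar>g (r k) (m (r k)) - f (m (r k))\<bar> < e / 3"
        by auto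
      with elim(1) max[of "r k" x] show ?case by linarith
    qed
    then show "f x \<le> f l + e" by simp
  qed
  then show "f x \<le> f l" .
  show "(\<lambda>n. g n (m n)) \<longlonglongrightarrow> f l"
    unfolding tendsto_iff
  proof (intro allI impI)
    fix e :: real assume "0 < e"
    from unif[OF this] show "\<forall>\<^sub>F n in sequentially. dist (g n (m n)) (f l) < e"
    proof eventually_elim
      case (elim n)
      then have "\<bar>g n l - f l\<bar> < e" "\<bar>g n (m n) - f (m n)\<bar> < e" by auto
      with max[of n l] le[of "m n"] show ?case
        unfolding dist_real_def by linarith
    qed
  qed
qed

theorem theorem3p5:
  fixes \<mu>0 :: "'x::{banach, second_countable_topology} measure"
    and lik :: "'d::metric_space \<Rightarrow> 'x \<Rightarrow> real ^ 'p::finite \<Rightarrow> real"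
    and likN :: "nat \<Rightarrow> 'd \<Rightarrow> 'x \<Rightarrow> real ^ 'p \<Rightarrow> real"
    and U :: "'d \<Rightarrow> real"
    and Usurr :: "nat \<Rightarrow> 'd \<Rightarrow> real"
    and dstar :: "nat \<Rightarrow> 'd"
  assumes prior: "prob_space \<mu>0" "sets \<mu>0 = sets borel"
    and lik: "\<And>d. likelihood_density (lik d)"
    and likN: "\<And>N d. likelihood_density (likN N d)"
    and U: "\<And>d. U d = expected_utility \<mu>0 (lik d)"
    and Usurr: "\<And>N d. Usurr N d = expected_utility \<mu>0 (likN N d)"
    and A1: "\<exists>C1 > 0. \<exists>\<psi> :: nat \<Rightarrow> real. (\<forall>N. 0 \<le> \<psi> N) \<and> \<psi> \<longlonglongrightarrow> 0 \<and>
               (\<forall>d N. (\<integral>\<^sup>+x. kl_div (likN N d x) (lik d x) \<partial>\<mu>0) \<le> ennreal (C1 * \<psi> N))"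
    and A2: "\<And>dn d. dn \<longlonglongrightarrow> d \<Longrightarrow>
               (\<lambda>N. \<integral>\<^sup>+x. kl_div (lik (dn N) x) (lik d x) \<partial>\<mu>0) \<longlonglongrightarrow> 0"
    and A3: "\<exists>C0 > 0. \<forall>N d dn. dn \<longlonglongrightarrow> d \<longrightarrow>
               (\<integral>\<^sup>+y. (\<integral>\<^sup>+x. log_sq_weighted (lik d x y) (evidence \<mu>0 (lik d) y)
                                (lik d x y + likN N d x y + lik (dn N) x y) \<partial>\<mu>0) \<partial>lborel)
                 < ennreal C0"
    and argmax: "\<And>N. is_arg_max (Usurr N) (\<lambda>d. d \<in> UNIV) (dstar N)"
  shows "(\<forall>r dlim. strict_mono r \<and> (dstar \<circ> r) \<longlonglongrightarrow> dlim \<longrightarrow>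
            is_arg_max U (\<lambda>d. d \<in> UNIV) dlim \<and>
            liminf (\<lambda>N. ereal (Usurr N (dstar N))) = ereal (U dlim)) \<and>
         (\<forall>dlim. dstar \<longlonglongrightarrow> dlim \<longrightarrow>
            is_arg_max U (\<lambda>d. d \<in> UNIV) dlim \<and>
            (\<lambda>N. Usurr N (dstar N)) \<longlonglongrightarrow> U dlim)"
proof -
  obtain C1 \<psi> where \<psi>: "\<psi> \<longlonglongrightarrow> 0"
    and kl: "\<And>d N. (\<integral>\<^sup>+x. kl_div (likN N d x) (lik d x) \<partial>\<mu>0) \<le> ennreal (C1 * \<psi> N)"
    using A1 by blast
  obtain C where C: "0 < C"
    and sq: "\<And>N d dn. dn \<longlonglongrightarrow> d \<Longrightarrow>
      (\<integral>\<^sup>+y. (\<integral>\<^sup>+x. log_sq_weighted (lik d x y) (evidence \<mu>0 (lik d) y)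
        (lik d x y + likN N d x y + lik (dn N) x y) \<partial>\<mu>0) \<partial>lborel) < ennreal C"
    using A3 by blast
  note nonneg = likelihood_nonneg[OF lik] likelihood_nonneg[OF likN]
  \<comment> \<open>A3 carries the surrogate and the shifted density in one weight; monotonicity in
    the weight lets \<open>q\<close> be either. For the surrogate, the constant sequence
    \<open>d\<close> serves as \<open>dn\<close>.\<close>
  have sq_le: "(\<integral>\<^sup>+y. (\<integral>\<^sup>+x. log_sq_weighted (lik d x y) (evidence \<mu>0 (lik d) y)
      (lik d x y + q x y) \<partial>\<mu>0) \<partial>lborel) \<le> ennreal C"
    if "dn \<longlonglongrightarrow> d" "\<And>x y. 0 \<le> q x y" "\<And>x y. q x y \<le> likN N d x y + lik (dn N) x y" for N d dn q
    using that nonneg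
    by (intro order_trans[OF _ less_imp_le[OF sq[OF that(1), of N]]] nn_integral_mono log_sq_weighted_mono)
      (auto simp: add.assoc)

  have uniform: "\<forall>\<^sub>F N in sequentially. \<forall>d. \<bar>Usurr N d - U d\<bar> < e" if e: "0 < e" for e
  proof -
    obtain K where K: "0 < K"
      and diff: "\<And>p q :: 'x \<Rightarrow> real ^ 'p \<Rightarrow> real.
        likelihood_density p \<Longrightarrow> likelihood_density q \<Longrightarrow>
        (\<integral>\<^sup>+x. kl_div (q x) (p x) \<partial>\<mu>0) \<le> ennreal K \<Longrightarrow>
        (\<integral>\<^sup>+y. (\<integral>\<^sup>+x. log_sq_weighted (p x y) (evidence \<mu>0 p y) (p x y + q x y) \<partial>\<mu>0) \<partial>lborel) \<le> ennreal C \<Longrightarrow>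
        \<bar>expected_utility \<mu>0 q - expected_utility \<mu>0 p\<bar> < e"
      using expected_utility_diff_small[OF prior C e] by blast
    \<comment> \<open>The bound in A1 is the same for all \<open>d\<close>, so the index from which
      it falls below \<open>K\<close> does not depend on \<open>d\<close>.\<close>
    have "(\<lambda>N. C1 * \<psi> N) \<longlonglongrightarrow> C1 * 0" by (intro tendsto_intros \<psi>)
    then have "\<forall>\<^sub>F N in sequentially. C1 * \<psi> N < K"
      using K by (auto intro: order_tendstoD(2))
    then show ?thesis
    proof eventually_elim
      case (elim N)
      show ?case
      proof
        fix d
        show "\<bar>Usurr N d - U d\<bar> < e"
          unfolding U Usurr
        proof (rule diff[OF lik likN])
          show "(\<integral>\<^sup>+x. kl_div (likN N d x) (lik d x) \<partial>\<mu>0) \<le> ennreal K"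
            using kl[of N d] elim by (meson ennreal_leI less_imp_le order_trans)
        qed (rule sq_le[of "\<lambda>_. d" _ _ N], auto simp: nonneg)
      qed
    qed
  qed

  have cont: "(\<lambda>n. U (dn n)) \<longlonglongrightarrow> U d" if dn: "dn \<longlonglongrightarrow> d" for dn d
    unfolding tendsto_iff
  proof (intro allI impI)
    fix e :: real assume e: "0 < e"
    obtain K where K: "0 < K"
      and diff: "\<And>p q :: 'x \<Rightarrow> real ^ 'p \<Rightarrow> real.
        likelihood_density p \<Longrightarrow> likelihood_density q \<Longrightarrow>
        (\<integral>\<^sup>+x. kl_div (q x) (p x) \<partial>\<mu>0) \<le> ennreal K \<Longrightarrow>
        (\<integral>\<^sup>+y. (\<integral>\<^sup>+x. log_sq_weighted (p x y) (evidence \<mu>0 p y) (p x y + q x y) \<partial>\<mu>0) \<partial>lborel) \<le> ennreal C \<Longrightarrow>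
        \<bar>expected_utility \<mu>0 q - expected_utility \<mu>0 p\<bar> < e"
      using expected_utility_diff_small[OF prior C e] by blast
    have "\<forall>\<^sub>F N in sequentially. (\<integral>\<^sup>+x. kl_div (lik (dn N) x) (lik d x) \<partial>\<mu>0) < ennreal K"
      using order_tendstoD(2)[OF A2[OF dn], of "ennreal K"] K by simp
    then show "\<forall>\<^sub>F n in sequentially. dist (U (dn n)) (U d) < e"
    proof eventually_elim
      case (elim N)
      show ?case
        unfolding dist_real_def U
        by (rule diff[OF lik lik less_imp_le[OF elim]], rule sq_le[OF dn, of _ N]) (auto simp: nonneg)
    qed
  qed

  have max: "Usurr N d \<le> Usurr N (dstar N)" for N d
    using argmax[of N] by (simp only: is_arg_max_UNIV_iff)
  have main: "is_arg_max U (\<lambda>d. d \<in> UNIV) dlim \<and> (\<lambda>N. Usurr N (dstar N)) \<longlonglongrightarrow> U dlim"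
    if "strict_mono r" "(dstar \<circ> r) \<longlonglongrightarrow> dlim" for r dlim
    using arg_max_uniform_limit[OF uniform cont max that]
    by (simp only: is_arg_max_UNIV_iff) blast
  show ?thesis
  proof (intro conjI allI impI; (elim conjE)?)
    fix r :: "nat \<Rightarrow> nat" and dlim
    assume r: "strict_mono r" "(dstar \<circ> r) \<longlonglongrightarrow> dlim"
    show "is_arg_max U (\<lambda>d. d \<in> UNIV) dlim" using main[OF r] ..
    \<comment> \<open>Even when only a subsequence of maximizers converges, the full sequence of
      maxima does, so its lower limit is its limit.\<close>
    have "(\<lambda>N. ereal (Usurr N (dstar N))) \<longlonglongrightarrow> ereal (U dlim)"
      using main[OF r] by (intro tendsto_intros) auto
    then show "liminf (\<lambda>N. ereal (Usurr N (dstar N))) = ereal (U dlim)"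
      by (intro lim_imp_Liminf) auto
  next
    fix dlim assume "dstar \<longlonglongrightarrow> dlim"
    then have id: "strict_mono (id :: nat \<Rightarrow> nat)" "(dstar \<circ> id) \<longlonglongrightarrow> dlim"
      by (auto simp: strict_mono_def)
    show "is_arg_max U (\<lambda>d. d \<in> UNIV) dlim" "(\<lambda>N. Usurr N (dstar N)) \<longlonglongrightarrow> U dlim"
      using main[OF id] by auto
  qed
qed

end
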